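(* Let $n$ be a positive integer, let $\mathcal{H}$ be a separable complex Hilbert space, let $T\in B(\mathcal{H})$ be an operator that admits an extension that is $m$--normal for every $m\ge n$, and let $S_1$ and $S_2$ be minimal $n$--normal extensions of $T$. Then $S_1$ and $S_2$ are unitarily equivalent.
   Context: An operator $S\in B(\mathcal{K})$ is $m$--normal if $S^*S^m=S^mS^*$; equivalently, $S^m$ is normal. $S\in B(\mathcal{K})$ is an extension of $T\in B(\mathcal{H})$ if $\mathcal{H}\subseteq\mathcal{K}$ and $Sx=Tx$ for all $x\in\mathcal{H}$. An $n$--normal extension $S\in B(\mathcal{K})$ of $T\in B(\mathcal{H})$ is minimal if the only closed subspace $\mathcal{M}$ with $\mathcal{H}\subseteq\mathcal{M}\subseteq\mathcal{K}$, $S\mathcal{M}\subseteq\mathcal{M}$, and $S|_{\mathcal{M}}$ an $n$--normal extension of $T$, is $\mathcal{M}=\mathcal{K}$. *)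

theory Defs
  imports "HOL-Analysis.Analysis"
begin

section \<open>Complex Hilbert spaces\<close>

text \<open>
  A complex inner product space is presented as a real inner product space (which supplies norm,
  metric and topology) with a multiplication by complex scalars and a sesquilinear form, linear in
  the first argument, whose real part is the given real inner product. Every complex
  inner product space arises in this way from itself, with real inner product \<open>Re \<langle>x, y\<rangle>\<close>;
  in particular the norm is the usual one, since \<open>\<langle>x, x\<rangle>\<close> is real.
\<close>

class complex_inner = real_inner +
  fixes scaleC :: "complex \<Rightarrow> 'a \<Rightarrow> 'a"  (infixr \<open>*\<^sub>C\<close> 75)
    and cinner :: "'a \<Rightarrow> 'a \<Rightarrow> complex"
  assumes scaleC_add_right: "c *\<^sub>C (x + y) = c *\<^sub>C x + c *\<^sub>C y"
    and scaleC_add_left: "(c + d) *\<^sub>C x = c *\<^sub>C x + d *\<^sub>C x"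
    and scaleC_scaleC: "c *\<^sub>C d *\<^sub>C x = (c * d) *\<^sub>C x"
    and scaleC_of_real: "complex_of_real r *\<^sub>C x = r *\<^sub>R x"
    and cinner_add_left: "cinner (x + y) z = cinner x z + cinner y z"
    and cinner_scaleC_left: "cinner (c *\<^sub>C x) y = c * cinner x y"
    and cinner_commute: "cinner x y = cnj (cinner y x)"
    and Re_cinner: "Re (cinner x y) = inner x y"

class complex_hilbert_space = complex_inner + complete_space

instantiation complex :: complex_hilbert_space
begin

definition "scaleC c (x::complex) = c * x"
definition "cinner x (y::complex) = x * cnj y"

instance
  by standard
    (simp_all add: scaleC_complex_def cinner_complex_def algebra_simps scaleR_conv_of_real
      inner_complex_def)

end

definition csubspace :: "'a::complex_inner set \<Rightarrow> bool" where
  "csubspace M \<longleftrightarrow>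
     0 \<in> M \<and> (\<forall>x\<in>M. \<forall>y\<in>M. x + y \<in> M) \<and> (\<forall>c. \<forall>x\<in>M. c *\<^sub>C x \<in> M)"

definition bounded_clinear :: "('a::complex_inner \<Rightarrow> 'b::complex_inner) \<Rightarrow> bool" where
  "bounded_clinear f \<longleftrightarrow> bounded_linear f \<and> (\<forall>c x. f (c *\<^sub>C x) = c *\<^sub>C f x)"

definition hilbert_embedding :: "('a::complex_inner \<Rightarrow> 'b::complex_inner) \<Rightarrow> bool" where
  "hilbert_embedding J \<longleftrightarrow>
     bounded_clinear J \<and> (\<forall>x y. cinner (J x) (J y) = cinner x y)"

definition unitary_map :: "('a::complex_inner \<Rightarrow> 'b::complex_inner) \<Rightarrow> bool" where
  "unitary_map U \<longleftrightarrow> hilbert_embedding U \<and> surj U"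

definition unitarily_equivalent ::
    "('a::complex_inner \<Rightarrow> 'a) \<Rightarrow> ('b::complex_inner \<Rightarrow> 'b) \<Rightarrow> bool" where
  "unitarily_equivalent S1 S2 \<longleftrightarrow> (\<exists>U. unitary_map U \<and> U \<circ> S1 = S2 \<circ> U)"

section \<open>Adjoints and m-normality\<close>

text \<open>
  Let \<open>M\<close> be a closed subspace invariant under the bounded operator \<open>S\<close>. The following two
  notions refer to the restriction of \<open>S\<close> to an operator on the Hilbert space \<open>M\<close>; the case of
  \<open>S\<close> itself is \<open>M = UNIV\<close>. The adjoint of the restriction takes values in \<open>M\<close> and in general
  differs from the restriction of the adjoint of \<open>S\<close>. Its defining vector exists by the Riesz
  representation theorem and is unique since it lies in \<open>M\<close>; the values of \<open>cadjoint_on M S\<close>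
  outside \<open>M\<close> are irrelevant.
\<close>

definition cadjoint_on ::
    "'a::complex_inner set \<Rightarrow> ('a \<Rightarrow> 'a) \<Rightarrow> 'a \<Rightarrow> 'a" where
  "cadjoint_on M S y = (THE z. z \<in> M \<and> (\<forall>x\<in>M. cinner (S x) y = cinner x z))"

definition m_normal_on ::
    "'a::complex_inner set \<Rightarrow> nat \<Rightarrow> ('a \<Rightarrow> 'a) \<Rightarrow> bool" where
  "m_normal_on M m S \<longleftrightarrow>
     (\<forall>x\<in>M. cadjoint_on M S ((S ^^ m) x) = (S ^^ m) (cadjoint_on M S x))"

section \<open>Extensions\<close>

text \<open>
  The spaces \<open>H\<close> and \<open>K\<close> are types, so the inclusion of \<open>H\<close> in \<open>K\<close> is given by an embedding
  \<open>J\<close> of Hilbert spaces, and \<open>H\<close> as a subset of \<open>K\<close> is \<open>range J\<close>. For \<open>S\<close> on \<open>K\<close> and \<open>M\<close> a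
  subset of \<open>K\<close>, the predicate says that \<open>M\<close> is a closed \<open>S\<close>-invariant subspace containing
  \<open>H\<close> and the restriction of \<open>S\<close> to \<open>M\<close> is an extension of \<open>T\<close>.
\<close>

definition extension_on ::
    "'k::complex_hilbert_space set \<Rightarrow> ('h::complex_hilbert_space \<Rightarrow> 'k) \<Rightarrow>
      ('h \<Rightarrow> 'h) \<Rightarrow> ('k \<Rightarrow> 'k) \<Rightarrow> bool" where
  "extension_on M J T S \<longleftrightarrow>
     hilbert_embedding J \<and> bounded_clinear S \<and>
     csubspace M \<and> closed M \<and> range J \<subseteq> M \<and> S ` M \<subseteq> M \<and>
     (\<forall>x. S (J x) = J (T x))"

definition minimal_n_normal_extension ::
    "nat \<Rightarrow> ('h::complex_hilbert_space \<Rightarrow> 'k::complex_hilbert_space) \<Rightarrow>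
      ('h \<Rightarrow> 'h) \<Rightarrow> ('k \<Rightarrow> 'k) \<Rightarrow> bool" where
  "minimal_n_normal_extension n J T S \<longleftrightarrow>
     extension_on UNIV J T S \<and> m_normal_on UNIV n S \<and>
     (\<forall>M. extension_on M J T S \<and> m_normal_on M n S \<longrightarrow> M = UNIV)"

end

theory Submission
  imports Defs
begin

text \<open>
  Let \<open>S\<close> on \<open>K\<close> be an \<open>n\<close>-normal extension of \<open>T\<close>, and let \<open>N = S\<^sup>n\<close>. By definition
  \<open>S*\<close> commutes with \<open>N\<close>; taking adjoints, \<open>S\<close> commutes with \<open>N*\<close>
  (\<open>m_normal_adjoint_commute\<close>). So on the vectors \<open>N*\<^sup>k h\<close> with \<open>h \<in> H\<close> the operator \<open>S\<close> acts as
  \<open>T\<close> acts on \<open>h\<close>: \<open>S N*\<^sup>k h = N*\<^sup>k T h\<close>.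

  The closed span of these vectors is therefore invariant under \<open>S\<close> and under \<open>N*\<close>. Invariance
  under \<open>N*\<close> makes the restriction of \<open>S\<close> to it \<open>n\<close>-normal again, and if \<open>S\<close> is minimal, it is all
  of \<open>K\<close> (\<open>closure_span_orbit\<close>). Hence \<open>S\<close> is determined by its action on these vectors, and what
  remains is their geometry. Moving the powers of \<open>N*\<close> to the other side of the inner product gives
  (\<open>inner_orbit\<close>)
  \<open>\<langle>N*\<^sup>j h, N*\<^sup>k g\<rangle> = \<langle>T\<^sup>n\<^sup>k h, T\<^sup>n\<^sup>j g\<rangle>\<close>,
  which mentions only \<open>T\<close>.

  Two minimal extensions thus have spanning families with the same inner products. So
  \<open>N\<^sub>1*\<^sup>k h \<mapsto> N\<^sub>2*\<^sup>k h\<close> extends to a unitary, which intertwines \<open>S\<^sub>1\<close> and \<open>S\<^sub>2\<close> because it does so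
  on the spanning family. Its graph is the closed span of the pairs \<open>(N\<^sub>1*\<^sup>k h, N\<^sub>2*\<^sup>k h)\<close> in the
  product space: on it the two components have equal norms, so it is single-valued, and completeness
  makes its projections onto both factors surjective.

  The family is stable under complex scalars, since \<open>c N*\<^sup>k h = N*\<^sup>k (c h)\<close>. Real spans and real
  inner products therefore suffice for most of the argument, and complex linearity enters as
  commutation with the maps \<open>x \<mapsto> c x\<close>.
\<close>

section \<open>Riesz representation on a closed subspace\<close>

text \<open>
  The representing vector is the minimiser on \<open>M\<close> of \<open>q x = \<parallel>x\<parallel>\<^sup>2 - 2 f x\<close>, which differs from
  \<open>\<parallel>x - z\<parallel>\<^sup>2\<close> only by a constant. The parallelogram law makes minimising sequences Cauchy, and the
  vanishing first variation of \<open>q\<close> at the minimum is the representation.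
\<close>

lemma riesz_on_closed_subspace:
  fixes f :: "'a::{real_inner, complete_space} \<Rightarrow> real"
  assumes f: "bounded_linear f" and M: "subspace M" "closed M"
  obtains z where "z \<in> M" "\<And>w. w \<in> M \<Longrightarrow> f w = inner w z"
proof -
  interpret f: bounded_linear f by fact
  define q where "q x = inner x x - 2 * f x" for x :: 'a
  obtain B where B: "\<And>x. norm (f x) \<le> norm x * B"
    using f.bounded by blast
  have bdd: "bdd_below (q ` M)"
  proof (rule bdd_belowI2)
    fix x :: 'a
    have "0 \<le> (norm x - B)\<^sup>2" by simp
    moreover have "f x \<le> norm x * B" using B[of x] by simp
    ultimately show "- B\<^sup>2 \<le> q x"
      by (simp add: q_def power2_norm_eq_inner[symmetric] power2_eq_square algebra_simps)
  qed
  define d where "d = Inf (q ` M)"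
  have M0: "0 \<in> M" using M(1) by (rule subspace_0)
  have d_le: "d \<le> q x" if "x \<in> M" for x
    unfolding d_def using bdd that by (intro cInf_lower) auto
  have "\<exists>x\<in>M. q x < d + 1 / real (Suc k)" for k
  proof -
    have "\<exists>y\<in>q ` M. y < d + 1 / real (Suc k)"
      using M0 by (intro cInf_lessD) (auto simp: d_def)
    then show ?thesis by blast
  qed
  then obtain X where XM: "\<And>k. X k \<in> M" and Xq: "\<And>k. q (X k) < d + 1 / real (Suc k)"
    by metis
  have par: "(norm (x - y))\<^sup>2 = 2 * q x + 2 * q y - 4 * q ((1/2) *\<^sub>R (x + y))" for x y
    by (simp add: q_def power2_norm_eq_inner f.add f.scaleR inner_add_left inner_add_right
        inner_diff_left inner_diff_right inner_commute[of y x] algebra_simps)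
  have near: "(norm (X j - X k))\<^sup>2 \<le> 2 / real (Suc j) + 2 / real (Suc k)" for j k
  proof -
    have "(1/2) *\<^sub>R (X j + X k) \<in> M"
      using M(1) XM by (intro subspace_scale subspace_add) auto
    note d_le[OF this]
    moreover have "2 / real (Suc i) = 2 * (1 / real (Suc i))" for i by simp
    ultimately show ?thesis
      using Xq[of j] Xq[of k] unfolding par[of "X j" "X k"] by (smt (verit))
  qed
  have "Cauchy X"
  proof (rule CauchyI)
    fix e :: real assume "e > 0"
    then obtain N where N: "4 / real (Suc N) < e\<^sup>2"
      using reals_Archimedean[of "e\<^sup>2 / 4"] by (auto simp: field_simps)
    have "norm (X j - X k) < e" if "j \<ge> N" "k \<ge> N" for j k
    proof -
      have "2 / real (Suc j) \<le> 2 / real (Suc N)" "2 / real (Suc k) \<le> 2 / real (Suc N)"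
        using that by (intro divide_left_mono; simp)+
      then have "(norm (X j - X k))\<^sup>2 < e\<^sup>2"
        using near[of j k] N by simp
      then show ?thesis using \<open>e > 0\<close> by (intro power2_less_imp_less[of _ e]) auto
    qed
    then show "\<exists>N. \<forall>j\<ge>N. \<forall>k\<ge>N. norm (X j - X k) < e" by blast
  qed
  then obtain z where z: "X \<longlonglongrightarrow> z"
    using Cauchy_convergent_iff convergent_def by blast
  have zM: "z \<in> M" using M(2) XM z by (meson closed_sequentially)
  have "(\<lambda>k. q (X k)) \<longlonglongrightarrow> q z"
    unfolding q_def by (intro tendsto_intros z f.tendsto)
  moreover have "(\<lambda>k. d + 1 / real (Suc k)) \<longlonglongrightarrow> d + 0"
    by (intro tendsto_intros LIMSEQ_Suc lim_1_over_n)
  ultimately have qz: "q z \<le> d"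
    using Xq by (intro LIMSEQ_le[of "\<lambda>k. q (X k)" "q z" "\<lambda>k. d + 1 / real (Suc k)"])
      (auto intro: less_imp_le)
  have "f w = inner w z" if w: "w \<in> M" for w
  proof (rule ccontr)
    assume ne: "f w \<noteq> inner w z"
    define g where "g = inner w z - f w"
    define W where "W = inner w w"
    have "W \<ge> 0" by (simp add: W_def)
    have quad: "0 \<le> 2 * t * g + t\<^sup>2 * W" for t
    proof -
      have "z + t *\<^sub>R w \<in> M"
        using M(1) zM w by (intro subspace_add subspace_scale)
      from d_le[OF this] qz have "q z \<le> q (z + t *\<^sub>R w)" by linarith
      then show ?thesis
        by (simp add: q_def g_def W_def f.add f.scaleR inner_add_left inner_add_right
            inner_commute[of z w] power2_eq_square algebra_simps)
    qed
    \<comment> \<open>The minimiser in \<open>t\<close> would be \<open>- g / W\<close>; adding 1 to \<open>W\<close> keeps the step defined if \<open>w = 0\<close>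
      and still makes the quadratic negative.\<close>
    have "2 * (- g / (W + 1)) * g + (- g / (W + 1))\<^sup>2 * W = - (g\<^sup>2 * (W + 2)) / (W + 1)\<^sup>2"
      using \<open>W \<ge> 0\<close> by (simp add: divide_simps power2_eq_square) (simp add: algebra_simps)
    moreover have "g\<^sup>2 * (W + 2) / (W + 1)\<^sup>2 > 0"
      using ne \<open>W \<ge> 0\<close> by (intro divide_pos_pos mult_pos_pos) (auto simp: g_def)
    ultimately show False using quad[of "- g / (W + 1)"] by simp
  qed
  with zM that show thesis by blast
qed

section \<open>Complex scalars and adjoints\<close>

lemma inner_scaleC_left: "inner (c *\<^sub>C x) y = inner x (cnj c *\<^sub>C y)"
proof -
  have "cinner x (cnj c *\<^sub>C y) = c * cinner x y"
    by (subst cinner_commute) (simp add: cinner_scaleC_left cinner_commute[of y x])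
  then show ?thesis by (metis Re_cinner cinner_scaleC_left)
qed

lemma norm_scaleC: "norm (c *\<^sub>C x) = cmod c * norm x"
proof -
  have "(norm (c *\<^sub>C x))\<^sup>2 = inner x ((cnj c * c) *\<^sub>C x)"
    by (simp add: power2_norm_eq_inner inner_scaleC_left scaleC_scaleC)
  also have "cnj c * c = complex_of_real ((cmod c)\<^sup>2)"
    by (metis complex_norm_square mult.commute)
  finally have "(norm (c *\<^sub>C x))\<^sup>2 = (cmod c * norm x)\<^sup>2"
    by (simp only: scaleC_of_real inner_scaleR_right power_mult_distrib power2_norm_eq_inner)
  then show ?thesis by simp
qed

lemma scaleC_scaleR_commute: "c *\<^sub>C (r *\<^sub>R x) = r *\<^sub>R (c *\<^sub>C x)"
  by (metis scaleC_of_real scaleC_scaleC mult.commute)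

lemma bounded_linear_scaleC: "bounded_linear (\<lambda>x. c *\<^sub>C x)"
  by (rule bounded_linear_intro[of _ "cmod c"])
    (simp_all add: scaleC_add_right scaleC_scaleR_commute norm_scaleC)

lemma csubspace_imp_subspace: "csubspace M \<Longrightarrow> subspace M"
  unfolding csubspace_def subspace_def by (metis scaleC_of_real)

text \<open>
  The real inner product is the real part of the complex one; replacing \<open>x\<close> by \<open>\<i> x\<close> recovers the
  imaginary part.
\<close>

lemma cinner_eq_of_inner_eq:
  assumes "\<And>c. inner (c *\<^sub>C x) y = inner (c *\<^sub>C x') y'"
  shows "cinner x y = cinner x' y'"
proof (rule complex_eqI)
  have "Re (c * cinner x y) = Re (c * cinner x' y')" for c
    using assms[of c] by (simp only: Re_cinner[symmetric] cinner_scaleC_left)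
  from this[of 1] this[of "\<i>"]
  show "Re (cinner x y) = Re (cinner x' y')" "Im (cinner x y) = Im (cinner x' y')"
    by simp_all
qed

text \<open>
  The adjoint can be recognised by the real inner product alone, since \<open>M\<close> is stable under complex
  scalars. This reduces its existence to the real representation theorem.
\<close>

lemma cadjoint_on_eqI:
  assumes S: "bounded_clinear S" and M: "csubspace M"
    and z: "z \<in> M" "\<And>x. x \<in> M \<Longrightarrow> inner (S x) y = inner x z"
  shows "cadjoint_on M S y = z"
  unfolding cadjoint_on_def
proof (rule the_equality, intro conjI ballI)
  fix x assume x: "x \<in> M"
  show "cinner (S x) y = cinner x z"
  proof (rule cinner_eq_of_inner_eq)
    fix c
    have "inner (S (c *\<^sub>C x)) y = inner (c *\<^sub>C x) z"
      using M x by (intro z(2)) (simp add: csubspace_def)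
    then show "inner (c *\<^sub>C S x) y = inner (c *\<^sub>C x) z"
      using S by (simp add: bounded_clinear_def)
  qed
next
  fix z' assume z': "z' \<in> M \<and> (\<forall>x\<in>M. cinner (S x) y = cinner x z')"
  have "inner x z' = inner x z" if "x \<in> M" for x
    using z' z(2)[OF that] that by (metis Re_cinner)
  moreover have "z' - z \<in> M"
    using csubspace_imp_subspace[OF M] z' z(1) by (intro subspace_diff) auto
  ultimately have "inner (z' - z) (z' - z) = 0"
    by (simp add: inner_diff_right)
  then show "z' = z" by simp
qed (rule z(1))

lemma cadjoint_on_props:
  fixes S :: "'a::complex_hilbert_space \<Rightarrow> 'a"
  assumes S: "bounded_clinear S" and M: "csubspace M" "closed M"
  shows "cadjoint_on M S y \<in> M"
    and "x \<in> M \<Longrightarrow> inner (S x) y = inner x (cadjoint_on M S y)"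
proof -
  have "bounded_linear (\<lambda>x. inner (S x) y)"
    using S by (intro bounded_linear_inner_left_comp) (simp add: bounded_clinear_def)
  then obtain z where z: "z \<in> M" "\<And>x. x \<in> M \<Longrightarrow> inner (S x) y = inner x z"
    using riesz_on_closed_subspace csubspace_imp_subspace[OF M(1)] M(2) by blast
  with cadjoint_on_eqI[OF S M(1)] have "cadjoint_on M S y = z" by blast
  with z show "cadjoint_on M S y \<in> M"
    and "x \<in> M \<Longrightarrow> inner (S x) y = inner x (cadjoint_on M S y)"
    by auto
qed

lemma csubspace_UNIV: "csubspace UNIV"
  by (simp add: csubspace_def)

lemmas inner_cadjoint = cadjoint_on_props(2)[OF _ csubspace_UNIV closed_UNIV UNIV_I]

lemma vector_eq_inner_left: "(\<And>w. inner w x = inner w y) \<Longrightarrow> x = y"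
  for x y :: "'a::real_inner"
  by (metis inner_commute vector_eq_ldot)

lemma bounded_clinear_cadjoint:
  fixes S :: "'a::complex_hilbert_space \<Rightarrow> 'a"
  assumes S: "bounded_clinear S"
  shows "bounded_clinear (cadjoint_on UNIV S)"
proof -
  interpret S: bounded_linear S using S by (simp add: bounded_clinear_def)
  note adj = inner_cadjoint[OF S, symmetric]
  obtain K where K: "\<And>x. norm (S x) \<le> norm x * K" and "K \<ge> 0"
    using S.nonneg_bounded by blast
  have "bounded_linear (cadjoint_on UNIV S)"
  proof (rule bounded_linear_intro[of _ K])
    fix x y r
    show "cadjoint_on UNIV S (x + y) = cadjoint_on UNIV S x + cadjoint_on UNIV S y"
      by (rule vector_eq_inner_left) (simp add: adj inner_add_right)
    show "cadjoint_on UNIV S (r *\<^sub>R x) = r *\<^sub>R cadjoint_on UNIV S x"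
      by (rule vector_eq_inner_left) (simp add: adj)
    let ?z = "cadjoint_on UNIV S x"
    have "norm ?z * norm ?z = inner (S ?z) x"
      by (simp add: adj[symmetric] power2_norm_eq_inner[symmetric] power2_eq_square)
    also have "\<dots> \<le> norm (S ?z) * norm x" by (rule norm_cauchy_schwarz)
    also have "\<dots> \<le> norm ?z * K * norm x"
      using K by (intro mult_right_mono) auto
    finally show "norm ?z \<le> norm x * K"
      using \<open>K \<ge> 0\<close> by (cases "?z = 0") (simp_all add: mult.assoc mult.commute[of K])
  qed
  moreover have "cadjoint_on UNIV S (c *\<^sub>C x) = c *\<^sub>C cadjoint_on UNIV S x" for c x
  proof (rule vector_eq_inner_left)
    fix w
    have "inner w (cadjoint_on UNIV S (c *\<^sub>C x)) = inner (S (cnj c *\<^sub>C w)) x"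
      using S by (simp add: adj inner_scaleC_left bounded_clinear_def)
    also have "\<dots> = inner w (c *\<^sub>C cadjoint_on UNIV S x)"
      by (simp add: adj[symmetric] inner_scaleC_left)
    finally show "inner w (cadjoint_on UNIV S (c *\<^sub>C x)) = inner w (c *\<^sub>C cadjoint_on UNIV S x)" .
  qed
  ultimately show ?thesis by (simp add: bounded_clinear_def)
qed

lemma bounded_clinear_funpow:
  fixes S :: "'a::complex_inner \<Rightarrow> 'a"
  assumes "bounded_clinear S"
  shows "bounded_clinear (S ^^ m)"
proof (induction m)
  case 0
  then show ?case by (simp add: bounded_clinear_def bounded_linear_ident id_def)
next
  case (Suc m)
  then show ?case
    using assms bounded_linear_compose[of S "S ^^ m"] by (simp add: bounded_clinear_def comp_def)
qed

text \<open>
  This is the adjoint of the defining identity \<open>S* S\<^sup>n = S\<^sup>n S*\<close>.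
\<close>

lemma m_normal_adjoint_commute:
  fixes S :: "'a::complex_hilbert_space \<Rightarrow> 'a"
  assumes S: "bounded_clinear S" and norm: "m_normal_on UNIV n S"
  shows "cadjoint_on UNIV (S ^^ n) (S x) = S (cadjoint_on UNIV (S ^^ n) x)"
proof (rule vector_eq_inner_left)
  fix w
  let ?N = "S ^^ n"
  note N = bounded_clinear_funpow[OF S]
  have comm: "cadjoint_on UNIV S (?N w) = ?N (cadjoint_on UNIV S w)"
    using norm by (simp add: m_normal_on_def)
  have "inner w (cadjoint_on UNIV ?N (S x)) = inner (S x) (?N w)"
    by (simp add: inner_cadjoint[OF N, symmetric] inner_commute)
  also have "\<dots> = inner x (?N (cadjoint_on UNIV S w))"
    by (simp add: inner_cadjoint[OF S] comm)
  also have "\<dots> = inner (S (cadjoint_on UNIV ?N x)) w"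
    by (simp add: inner_cadjoint[OF S] inner_commute[of x] inner_cadjoint[OF N]
        inner_commute[of "cadjoint_on UNIV S w"])
  finally show "inner w (cadjoint_on UNIV ?N (S x)) = inner w (S (cadjoint_on UNIV ?N x))"
    by (simp add: inner_commute)
qed

section \<open>Closed linear spans\<close>

lemma subspace_closure:
  fixes V :: "'a::real_normed_vector set"
  assumes "subspace V"
  shows "subspace (closure V)"
  unfolding subspace_def
proof (intro conjI ballI allI)
  show "0 \<in> closure V" using assms closure_subset subspace_0 by blast
next
  fix x y assume "x \<in> closure V" "y \<in> closure V"
  then obtain X Y where "\<And>k. X k \<in> V" "X \<longlonglongrightarrow> x" "\<And>k. Y k \<in> V" "Y \<longlonglongrightarrow> y"
    unfolding closure_sequential by blast
  then show "x + y \<in> closure V"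
    unfolding closure_sequential using assms
    by (intro exI[of _ "\<lambda>k. X k + Y k"]) (auto intro: tendsto_add subspace_add)
next
  fix r x assume "x \<in> closure V"
  then obtain X where "\<And>k. X k \<in> V" "X \<longlonglongrightarrow> x"
    unfolding closure_sequential by blast
  then show "r *\<^sub>R x \<in> closure V"
    unfolding closure_sequential using assms
    by (intro exI[of _ "\<lambda>k. r *\<^sub>R X k"]) (auto intro: tendsto_scaleR subspace_scale)
qed

lemma closure_span_invariant:
  fixes f :: "'a::real_normed_vector \<Rightarrow> 'b::real_normed_vector"
  assumes f: "bounded_linear f" and B: "\<And>b. b \<in> B \<Longrightarrow> f b \<in> C"
    and x: "x \<in> closure (span B)"
  shows "f x \<in> closure (span C)"
proof -
  have "f ` span B \<subseteq> span C"
    using linear_span_image[OF bounded_linear.linear[OF f], of B] B span_mono[of "f ` B" C] by blast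
  then have "closure (f ` span B) \<subseteq> closure (span C)" by (rule closure_mono)
  with closure_bounded_linear_image_subset[OF f, of "span B"] x show ?thesis by blast
qed

section \<open>The minimal extension\<close>

text \<open>
  The orbit of \<open>H\<close> under the powers of \<open>(S\<^sup>n)*\<close>. Exponent and vector are paired so that the whole
  family is indexed by a single type.
\<close>

definition orbit_vector :: "nat \<Rightarrow> ('h \<Rightarrow> 'k::complex_hilbert_space) \<Rightarrow> ('k \<Rightarrow> 'k) \<Rightarrow> nat \<times> 'h \<Rightarrow> 'k" where
  "orbit_vector n J S p = (cadjoint_on UNIV (S ^^ n) ^^ fst p) (J (snd p))"

context
  fixes n :: nat and J :: "'h::complex_hilbert_space \<Rightarrow> 'k::complex_hilbert_space"
    and T :: "'h \<Rightarrow> 'h" and S :: "'k \<Rightarrow> 'k"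
  assumes min: "minimal_n_normal_extension n J T S"
begin

abbreviation (input) "N \<equiv> S ^^ n"
abbreviation (input) "Nadj \<equiv> cadjoint_on UNIV (S ^^ n)"
abbreviation (input) "v \<equiv> orbit_vector n J S"

lemma bounded_clinear_ext: "bounded_clinear S" "bounded_clinear J"
  and inner_J: "inner (J x) (J y) = inner x y"
  and S_J: "S (J x) = J (T x)"
  using min by (auto simp: minimal_n_normal_extension_def extension_on_def hilbert_embedding_def
      Re_cinner[symmetric])

lemma inner_Nadj: "inner (N x) y = inner x (Nadj y)"
  by (rule inner_cadjoint[OF bounded_clinear_funpow[OF bounded_clinear_ext(1)]])

lemma bounded_clinear_Nadj: "bounded_clinear Nadj"
  by (rule bounded_clinear_cadjoint[OF bounded_clinear_funpow[OF bounded_clinear_ext(1)]])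

lemma Nadj_S: "Nadj (S x) = S (Nadj x)"
  by (rule m_normal_adjoint_commute[OF bounded_clinear_ext(1)])
    (use min in \<open>simp add: minimal_n_normal_extension_def\<close>)

lemma Nadj_funpow_S: "(Nadj ^^ k) ((S ^^ m) x) = (S ^^ m) ((Nadj ^^ k) x)"
proof -
  have 1: "Nadj ((S ^^ m) x) = (S ^^ m) (Nadj x)" for x
    by (induction m) (simp_all add: Nadj_S)
  show ?thesis by (induction k) (simp_all add: 1)
qed

lemma S_funpow_J: "(S ^^ m) (J x) = J ((T ^^ m) x)"
  by (induction m) (simp_all add: S_J)

lemma S_orbit: "S (v (k, h)) = v (k, T h)"
  using Nadj_funpow_S[of k 1 "J h"] by (simp add: orbit_vector_def S_J)

lemma Nadj_orbit: "Nadj (v (k, h)) = v (Suc k, h)"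
  by (simp add: orbit_vector_def)

lemma scaleC_orbit: "c *\<^sub>C v (k, h) = v (k, c *\<^sub>C h)"
proof -
  have "(Nadj ^^ k) (c *\<^sub>C x) = c *\<^sub>C (Nadj ^^ k) x" for x
    using bounded_clinear_funpow[OF bounded_clinear_Nadj] by (simp add: bounded_clinear_def)
  then show ?thesis
    using bounded_clinear_ext(2) by (simp add: orbit_vector_def bounded_clinear_def)
qed

lemma inner_Nadj_funpow: "inner x ((Nadj ^^ k) y) = inner ((N ^^ k) x) y"
  by (induction k arbitrary: x) (simp_all add: inner_Nadj[symmetric] funpow_swap1[of N])

text \<open>
  Each power of \<open>N*\<close> turns into a power of \<open>N\<close> on the other side. On the side that already carries
  a power of \<open>N*\<close>, it is moved past that power by \<open>Nadj_funpow_S\<close>, so that powers of \<open>N\<close> meet only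
  vectors of \<open>H\<close>, where \<open>N\<close> is \<open>T\<^sup>n\<close>.
\<close>

lemma inner_orbit:
  "inner (v (j, h)) (v (k, g)) = inner ((T ^^ (n * k)) h) ((T ^^ (n * j)) g)"
proof -
  have "inner (v (j, h)) (v (k, g)) = inner ((S ^^ (n * k)) ((Nadj ^^ j) (J h))) (J g)"
    by (simp add: orbit_vector_def inner_Nadj_funpow funpow_mult)
  also have "\<dots> = inner (J ((T ^^ (n * k)) h)) ((N ^^ j) (J g))"
    by (simp add: Nadj_funpow_S[symmetric] S_funpow_J inner_commute[of "(Nadj ^^ j) _"]
        inner_Nadj_funpow) (simp add: inner_commute)
  also have "\<dots> = inner ((T ^^ (n * k)) h) ((T ^^ (n * j)) g)"
    by (simp add: funpow_mult S_funpow_J inner_J)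
  finally show ?thesis .
qed

text \<open>
  By minimality it suffices that the restriction of \<open>S\<close> to the closed span \<open>M\<close> is an \<open>n\<close>-normal
  extension. The delicate point is normality: nothing says a priori that \<open>S*\<close> leaves \<open>M\<close> invariant,
  so the adjoint of the restriction cannot be taken to be a restriction of \<open>S*\<close>. But \<open>N*\<close> does leave \<open>M\<close> invariant, and the relation
  \<open>N* S = S N*\<close> restricts to \<open>M\<close>, where its adjoint is the required identity.
\<close>

lemma closure_span_orbit: "closure (span (range v)) = UNIV"
proof -
  let ?M = "closure (span (range v))"
  have sub: "subspace ?M" by (intro subspace_closure subspace_span)
  note S = bounded_clinear_ext(1)
  have scale: "c *\<^sub>C x \<in> ?M" if "x \<in> ?M" for c x
    by (rule closure_span_invariant[OF bounded_linear_scaleC _ that]) (auto simp: scaleC_orbit)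
  have M: "csubspace ?M"
    unfolding csubspace_def using sub scale by (auto intro: subspace_0 subspace_add)
  have SM: "S x \<in> ?M" if "x \<in> ?M" for x
    using S by (intro closure_span_invariant[OF _ _ that]) (auto simp: S_orbit bounded_clinear_def)
  have NM: "N x \<in> ?M" if "x \<in> ?M" for x
  proof -
    have "(S ^^ m) x \<in> ?M" for m by (induction m) (simp_all add: SM that)
    then show ?thesis .
  qed
  have NadjM: "Nadj x \<in> ?M" if "x \<in> ?M" for x
    using bounded_clinear_Nadj
    by (intro closure_span_invariant[OF _ _ that]) (auto simp: Nadj_orbit bounded_clinear_def)
  have "J h \<in> ?M" for h
  proof -
    have "J h = v (0, h)" by (simp add: orbit_vector_def)
    then show ?thesis by (metis closure_subset rangeI span_base subsetD)
  qed
  then have ext: "extension_on ?M J T S"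
    using min M SM
    by (auto simp: minimal_n_normal_extension_def extension_on_def)
  have "m_normal_on ?M n S"
    unfolding m_normal_on_def
  proof
    fix x assume x: "x \<in> ?M"
    let ?z = "cadjoint_on ?M S x"
    note adj = cadjoint_on_props[OF S M closed_closure]
    show "cadjoint_on ?M S (N x) = N ?z"
    proof (rule cadjoint_on_eqI[OF S M])
      show "N ?z \<in> ?M" using adj(1) by (rule NM)
      fix w assume w: "w \<in> ?M"
      have "inner (S w) (N x) = inner (Nadj (S w)) x"
        using inner_Nadj[of x "S w"] by (simp add: inner_commute)
      also have "\<dots> = inner (Nadj w) ?z"
        by (simp add: Nadj_S adj(2)[OF NadjM[OF w]])
      also have "\<dots> = inner w (N ?z)"
        using inner_Nadj[of ?z w] by (simp add: inner_commute)
      finally show "inner (S w) (N x) = inner w (N ?z)" .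
    qed
  qed
  with ext min show ?thesis
    by (simp add: minimal_n_normal_extension_def)
qed

end

section \<open>Isometric extension from a spanning family\<close>

text \<open>
  Equality of inner products is bilinear, so it passes from the family to its span; the resulting
  equality of norms is a closed condition.
\<close>

lemma norm_eq_on_closure_span:
  fixes a :: "'i \<Rightarrow> 'a::real_inner" and b :: "'i \<Rightarrow> 'b::real_inner"
  assumes gram: "\<And>i j. inner (a i) (a j) = inner (b i) (b j)"
    and p: "p \<in> closure (span (range (\<lambda>i. (a i, b i))))"
  shows "norm (fst p) = norm (snd p)"
proof -
  let ?G = "range (\<lambda>i. (a i, b i))"
  have 1: "inner (fst p) (a j) = inner (snd p) (b j)" if "p \<in> span ?G" for p j
    using that by (induction rule: span_induct_alt) (auto simp: inner_add_left gram)
  have 2: "inner (fst p) (fst r) = inner (snd p) (snd r)" if "p \<in> span ?G" "r \<in> span ?G" for p r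
    using that(2) by (induction rule: span_induct_alt) (auto simp: inner_add_right 1[OF that(1)])
  have "span ?G \<subseteq> {p. norm (fst p) = norm (snd p)}"
    by (auto simp: norm_eq_sqrt_inner dest: 2)
  moreover have "closed {p :: 'a \<times> 'b. norm (fst p) = norm (snd p)}"
    by (intro closed_Collect_eq continuous_intros)
  ultimately show ?thesis using p closure_minimal by blast
qed

text \<open>
  By equality of norms, the first projection is bounded below on the closed span. Its image is
  therefore complete, hence closed, and it contains the dense span of the first family.
\<close>

lemma fst_closure_span_surj:
  fixes a :: "'i \<Rightarrow> 'a::{real_inner,complete_space}" and b :: "'i \<Rightarrow> 'b::{real_inner,complete_space}"
  assumes gram: "\<And>i j. inner (a i) (a j) = inner (b i) (b j)"
    and dense: "closure (span (range a)) = UNIV"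
  shows "fst ` closure (span (range (\<lambda>i. (a i, b i)))) = UNIV"
proof -
  let ?G = "range (\<lambda>i. (a i, b i))"
  have "complete (fst ` closure (span ?G))"
  proof (rule complete_isometric_image[of "1/2"])
    show "\<forall>p\<in>closure (span ?G). 1/2 * norm p \<le> norm (fst p)"
    proof
      fix p assume "p \<in> closure (span ?G)"
      from norm_eq_on_closure_span[OF gram this]
      show "1/2 * norm p \<le> norm (fst p)"
        using norm_Pair_le[of "fst p" "snd p"] by simp
    qed
  qed (auto intro: subspace_closure bounded_linear_fst simp: complete_eq_closed)
  then have "closed (fst ` closure (span ?G))" by (simp add: complete_eq_closed)
  moreover have "span (range a) \<subseteq> fst ` closure (span ?G)"
  proof -
    have "span (range a) = fst ` span ?G"
      using linear_span_image[OF bounded_linear.linear[OF bounded_linear_fst], of ?G]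
      by (simp add: image_image)
    then show ?thesis using closure_subset by blast
  qed
  ultimately show ?thesis using dense closure_minimal by blast
qed

lemma snd_closure_span_surj:
  fixes a :: "'i \<Rightarrow> 'a::{real_inner,complete_space}" and b :: "'i \<Rightarrow> 'b::{real_inner,complete_space}"
  assumes gram: "\<And>i j. inner (a i) (a j) = inner (b i) (b j)"
    and dense: "closure (span (range b)) = UNIV"
  shows "snd ` closure (span (range (\<lambda>i. (a i, b i)))) = UNIV"
proof -
  have "y \<in> snd ` closure (span (range (\<lambda>i. (a i, b i))))" for y
  proof -
    have "y \<in> fst ` closure (span (range (\<lambda>i. (b i, a i))))"
      using fst_closure_span_surj[of b a] gram dense by simp
    then obtain x where "(y, x) \<in> closure (span (range (\<lambda>i. (b i, a i))))" by auto
    from closure_span_invariant[OF bounded_linear_Pair[OF bounded_linear_snd bounded_linear_fst] _ this,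
        of "range (\<lambda>i. (a i, b i))"]
    show ?thesis by force
  qed
  then show ?thesis by blast
qed

section \<open>Uniqueness of the minimal extension\<close>

theorem corollary4p3:
  fixes n :: nat
    and T :: "'h::complex_hilbert_space \<Rightarrow> 'h"
    and J1 :: "'h \<Rightarrow> 'k1::complex_hilbert_space" and S1 :: "'k1 \<Rightarrow> 'k1"
    and J2 :: "'h \<Rightarrow> 'k2::complex_hilbert_space" and S2 :: "'k2 \<Rightarrow> 'k2"
  assumes "n > 0"
    and "separable_space (euclidean :: 'h topology)"
    and "bounded_clinear T"
    and "\<exists>(J :: 'h \<Rightarrow> 'k::complex_hilbert_space) (S :: 'k \<Rightarrow> 'k).
           extension_on UNIV J T S \<and> (\<forall>m\<ge>n. m_normal_on UNIV m S)"
    and "minimal_n_normal_extension n J1 T S1"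
    and "minimal_n_normal_extension n J2 T S2"
  shows "unitarily_equivalent S1 S2"
proof -
  note min1 = assms(5) and min2 = assms(6)
  define a where "a = orbit_vector n J1 S1"
  define b where "b = orbit_vector n J2 S2"
  have gram: "inner (a i) (a j) = inner (b i) (b j)" for i j
    by (cases i; cases j) (simp add: a_def b_def inner_orbit[OF min1] inner_orbit[OF min2])
  define G where "G = range (\<lambda>i. (a i, b i))"
  have GE: "\<exists>k h. p = (a (k, h), b (k, h))" if "p \<in> G" for p
    using that by (auto simp: G_def)
  have GI: "(a (k, h), b (k, h)) \<in> G" for k h
    by (auto simp: G_def)
  have G_scaleC: "(c *\<^sub>C fst p, c *\<^sub>C snd p) \<in> G" if "p \<in> G" for c p
    using GE[OF that] GI
    by (auto simp: a_def b_def scaleC_orbit[OF min1] scaleC_orbit[OF min2])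
  have G_S: "(S1 (fst p), S2 (snd p)) \<in> G" if "p \<in> G" for p
    using GE[OF that] GI
    by (auto simp: a_def b_def S_orbit[OF min1] S_orbit[OF min2])
  \<comment> \<open>The graph of the unitary.\<close>
  define \<Gamma> where "\<Gamma> = closure (span G)"
  have sub: "subspace \<Gamma>" unfolding \<Gamma>_def by (intro subspace_closure subspace_span)
  have norm_eq: "norm x = norm y" if "(x, y) \<in> \<Gamma>" for x y
    using norm_eq_on_closure_span[OF gram] that by (force simp: \<Gamma>_def G_def)
  have uniq: "y = y'" if "(x, y) \<in> \<Gamma>" "(x, y') \<in> \<Gamma>" for x y y'
    using subspace_diff[OF sub that] norm_eq[of 0 "y - y'"] by simp
  have "\<exists>y. (x, y) \<in> \<Gamma>" for x
  proof -
    have "x \<in> fst ` \<Gamma>"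
      using fst_closure_span_surj[of a b, OF gram] closure_span_orbit[OF min1]
      by (simp add: \<Gamma>_def G_def a_def)
    then show ?thesis by auto
  qed
  then obtain U where U: "\<And>x. (x, U x) \<in> \<Gamma>" by metis
  have U_eq: "U x = y" if "(x, y) \<in> \<Gamma>" for x y
    using uniq[OF U that] .
  have U_add: "U (x + y) = U x + U y" for x y
    using subspace_add[OF sub U[of x] U[of y]] by (intro U_eq) simp
  have U_scaleR: "U (r *\<^sub>R x) = r *\<^sub>R U x" for r x
    using subspace_scale[OF sub U[of x]] by (intro U_eq) simp
  have U_norm: "norm (U x) = norm x" for x
    using norm_eq[OF U] by simp
  have U_scaleC: "U (c *\<^sub>C x) = c *\<^sub>C U x" for c x
  proof (rule U_eq)
    have lin: "bounded_linear (\<lambda>p :: 'k1 \<times> 'k2. (c *\<^sub>C fst p, c *\<^sub>C snd p))"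
      by (intro bounded_linear_Pair bounded_linear_compose[OF bounded_linear_scaleC]
          bounded_linear_fst bounded_linear_snd)
    show "(c *\<^sub>C x, c *\<^sub>C U x) \<in> \<Gamma>"
      using closure_span_invariant[OF lin G_scaleC] U[of x] unfolding \<Gamma>_def by fastforce
  qed
  have U_S: "U (S1 x) = S2 (U x)" for x
  proof (rule U_eq)
    have lin: "bounded_linear (\<lambda>p. (S1 (fst p), S2 (snd p)))"
      using bounded_clinear_ext(1)[OF min1] bounded_clinear_ext(1)[OF min2]
      by (intro bounded_linear_Pair)
        (auto simp: bounded_clinear_def intro: bounded_linear_compose bounded_linear_fst
          bounded_linear_snd)
    show "(S1 x, S2 (U x)) \<in> \<Gamma>"
      using closure_span_invariant[OF lin G_S] U[of x] unfolding \<Gamma>_def by fastforce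
  qed
  have lin: "bounded_linear U"
    by (rule bounded_linear_intro[of _ 1]) (simp_all add: U_add U_scaleR U_norm)
  have U_inner: "inner (U x) (U y) = inner x y" for x y
    using U_norm[of "x + y"] by (simp add: dot_norm U_norm flip: U_add)
  have "cinner (U x) (U y) = cinner x y" for x y
    by (rule cinner_eq_of_inner_eq) (simp add: U_inner flip: U_scaleC)
  moreover have "surj U"
  proof -
    have "\<exists>x. (x, y) \<in> \<Gamma>" for y
    proof -
      have "y \<in> snd ` \<Gamma>"
        using snd_closure_span_surj[of a b, OF gram] closure_span_orbit[OF min2]
        by (simp add: \<Gamma>_def G_def b_def)
      then show ?thesis by auto
    qed
    then show ?thesis using U_eq by (metis surjI)
  qed
  ultimately have "unitary_map U"
    using lin U_scaleC
    by (simp add: unitary_map_def hilbert_embedding_def bounded_clinear_def)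
  then show ?thesis
    unfolding unitarily_equivalent_def using U_S by (intro exI[of _ U]) auto
qed

end
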